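(* Let $F=\frac1n\sum_{i=1}^n F_i:\mathbb{R}^d\to\mathbb{R}^d$ be $L$-Lipschitz and $\mu$-quasi strongly monotone with respect to a point $x_*$ with $F(x_* )=0$, and let the Expected Residual condition hold with parameter $\delta>0$. Let the SPEG step sizes be $\gamma_k=\omega_k=\omega$ for all $k$, where $0<\omega\le\min\left\{\frac{\mu}{18\delta},\frac{1}{4L}\right\}$. Then for all $k\ge 0$ the SPEG iterates satisfy $$R_k^2\le\left(1-\frac{\omega\mu}{2}\right)^kR_0^2+\frac{24\,\omega\,\sigma_*^2}{\mu},\qquad R_k^2:=\mathbb{E}\left[\|x_k-x_*\|^2+\|x_k-\hat x_{k-1}\|^2\right].$$ Hence, given any $\varepsilon>0$ and choosing $\omega=\min\left\{\frac{\mu}{18\delta},\frac1{4L},\frac{\varepsilon\mu}{48\sigma_*^2}\right\}$, SPEG achieves $\mathbb{E}\|x_K-x_*\|^2\le\varepsilon$ after $$K\ge\max\left\{\frac{8L}{\mu},\frac{36\delta}{\mu^2},\frac{96\sigma_*^2}{\varepsilon\mu^2}\right\}\log\left(\frac{2R_0^2}{\varepsilon}\right)$$ iterations.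
   Context: Stochastic estimator: $v\in\mathbb{R}^n_+$ is a random sampling vector with distribution $\mathcal D$ satisfying $\mathbb{E}_{\mathcal D}[v_i]=1$ for all $i$, and $F_v(x):=\frac1n\sum_{i=1}^n v_iF_i(x)$, so $\mathbb{E}_{\mathcal D}[F_v(x)]=F(x)$. SPEG (Stochastic Past Extragradient): $\hat x_{-1}=x_0$, the vectors $v_{-1},v_0,v_1,\dots$ are i.i.d. from $\mathcal D$, and for $k\ge0$ $$\hat x_k=x_k-\gamma_kF_{v_{k-1}}(\hat x_{k-1}),\qquad x_{k+1}=x_k-\omega_kF_{v_k}(\hat x_k).$$ $\mu$-quasi strongly monotone ($\mu>0$): $\langle F(x),x-x_*\rangle\ge\mu\|x-x_*\|^2$ for all $x$, where $F(x_* )=0$. Expected Residual (ER) condition with parameter $\delta>0$: for all $x$, $\mathbb{E}\left[\|(F_v(x)-F_v(x_* ))-(F(x)-F(x_* ))\|^2\right]\le\frac\delta2\|x-x_*\|^2$. $\sigma_*^2:=\mathbb{E}\|F_v(x_* )\|^2<\infty$. Terms with $\sigma_*^2$ in the denominator are read as $+\infty$ if $\sigma_*^2=0$. *)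

theory Defs
  imports "HOL-Probability.Probability"
begin

definition mean_op :: "('n::finite \<Rightarrow> real^'d \<Rightarrow> real^'d) \<Rightarrow> real^'d \<Rightarrow> real^'d" where
  "mean_op Fs x = (1 / real CARD('n)) *\<^sub>R (\<Sum>i\<in>UNIV. Fs i x)"

definition stoch_op :: "('n::finite \<Rightarrow> real^'d \<Rightarrow> real^'d) \<Rightarrow> real^'n \<Rightarrow> real^'d \<Rightarrow> real^'d" where
  "stoch_op Fs v x = (1 / real CARD('n)) *\<^sub>R (\<Sum>i\<in>UNIV. (v $ i) *\<^sub>R Fs i x)"

definition sampling_distribution :: "(real^'n::finite) measure \<Rightarrow> bool" where
  "sampling_distribution D \<longleftrightarrow>
     prob_space D \<and> sets D = sets borel \<and>
     (AE v in D. \<forall>i. 0 \<le> v $ i) \<and>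
     (\<forall>i. integrable D (\<lambda>v. v $ i) \<and> (\<integral>v. v $ i \<partial>D) = 1)"

definition quasi_strongly_monotone ::
    "real \<Rightarrow> (real^'d \<Rightarrow> real^'d) \<Rightarrow> real^'d \<Rightarrow> bool" where
  "quasi_strongly_monotone \<mu> G xs \<longleftrightarrow>
     0 < \<mu> \<and> G xs = 0 \<and> (\<forall>x. inner (G x) (x - xs) \<ge> \<mu> * (norm (x - xs))\<^sup>2)"

text \<open>
  The Bochner integral of a non-integrable function is 0, so wherever a bound on an
  expectation is meant to entail that it is finite, integrability is required explicitly.
\<close>

definition expected_residual ::
    "real \<Rightarrow> (real^'n::finite) measure \<Rightarrow> ('n \<Rightarrow> real^'d \<Rightarrow> real^'d) \<Rightarrow> real^'d \<Rightarrow> bool" where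
  "expected_residual \<delta> D Fs xs \<longleftrightarrow>
     (\<forall>x. integrable D (\<lambda>v. (norm ((stoch_op Fs v x - stoch_op Fs v xs)
                                  - (mean_op Fs x - mean_op Fs xs)))\<^sup>2) \<and>
          (\<integral>v. (norm ((stoch_op Fs v x - stoch_op Fs v xs)
                       - (mean_op Fs x - mean_op Fs xs)))\<^sup>2 \<partial>D)
            \<le> \<delta> / 2 * (norm (x - xs))\<^sup>2)"

definition noise_at_solution ::
    "(real^'n::finite) measure \<Rightarrow> ('n \<Rightarrow> real^'d \<Rightarrow> real^'d) \<Rightarrow> real^'d \<Rightarrow> real" where
  "noise_at_solution D Fs xs = (\<integral>v. (norm (stoch_op Fs v xs))\<^sup>2 \<partial>D)"

text \<open>
  The state after \<open>k\<close> iterations is the pair of \<open>x\<close> at index \<open>k\<close> and the extrapolated point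
  (x-hat) at index \<open>k - 1\<close>. Here \<open>v\<close> is one realisation of the sampling vectors, of which only
  the values at indices at least \<open>-1\<close> are used.
\<close>

primrec speg_state ::
    "(nat \<Rightarrow> real) \<Rightarrow> (nat \<Rightarrow> real) \<Rightarrow> ('n::finite \<Rightarrow> real^'d \<Rightarrow> real^'d) \<Rightarrow> real^'d
      \<Rightarrow> (int \<Rightarrow> real^'n) \<Rightarrow> nat \<Rightarrow> (real^'d) \<times> (real^'d)" where
  "speg_state \<gamma> \<omega> Fs x0 v 0 = (x0, x0)"
| "speg_state \<gamma> \<omega> Fs x0 v (Suc k) =
     (let (x, xhat_prev) = speg_state \<gamma> \<omega> Fs x0 v k;
          xhat = x - \<gamma> k *\<^sub>R stoch_op Fs (v (int k - 1)) xhat_prev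
      in (x - \<omega> k *\<^sub>R stoch_op Fs (v (int k)) xhat, xhat))"

definition speg_x where
  "speg_x \<gamma> \<omega> Fs x0 v k = fst (speg_state \<gamma> \<omega> Fs x0 v k)"

definition speg_xhat_prev where
  "speg_xhat_prev \<gamma> \<omega> Fs x0 v k = snd (speg_state \<gamma> \<omega> Fs x0 v k)"

definition speg_sq_err ::
    "(nat \<Rightarrow> real) \<Rightarrow> (nat \<Rightarrow> real) \<Rightarrow> ('n::finite \<Rightarrow> real^'d \<Rightarrow> real^'d) \<Rightarrow> real^'d
      \<Rightarrow> (int \<Rightarrow> real^'n) \<Rightarrow> real^'d \<Rightarrow> nat \<Rightarrow> real" where
  "speg_sq_err \<gamma> \<omega> Fs x0 v xs k =
     (norm (speg_x \<gamma> \<omega> Fs x0 v k - xs))\<^sup>2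
     + (norm (speg_x \<gamma> \<omega> Fs x0 v k - speg_xhat_prev \<gamma> \<omega> Fs x0 v k))\<^sup>2"

text \<open>\<open>speg_R2 M \<dots> k\<close> is \<open>R\<^sub>k\<^sup>2\<close>; here \<open>v j\<close> is a random vector on \<open>M\<close>.\<close>

definition speg_R2 ::
    "'w measure \<Rightarrow> (nat \<Rightarrow> real) \<Rightarrow> (nat \<Rightarrow> real) \<Rightarrow> ('n::finite \<Rightarrow> real^'d \<Rightarrow> real^'d)
      \<Rightarrow> real^'d \<Rightarrow> (int \<Rightarrow> 'w \<Rightarrow> real^'n) \<Rightarrow> real^'d \<Rightarrow> nat \<Rightarrow> real" where
  "speg_R2 M \<gamma> \<omega> Fs x0 v xs k =
     (\<integral>w. speg_sq_err \<gamma> \<omega> Fs x0 (\<lambda>j. v j w) xs k \<partial>M)"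

end

theory Submission
  imports Defs
begin

text \<open>
  Write \<open>y\<close> for the previous extrapolated point, \<open>z = x - \<omega> g'\<close> for the new one and
  \<open>x' = x - \<omega> g\<close> for the new iterate, where \<open>g'\<close> and \<open>g\<close> are the stochastic operators at \<open>y\<close>
  and \<open>z\<close>. Expanding squares gives, with no inequality at all,
  \<open>|x' - xs|^2 + |x' - z|^2 = |x - xs|^2 - |z - x|^2 - 2 \<omega> \<langle>g, z - xs\<rangle> + 2 \<omega>^2 |g - g'|^2\<close>.
  The negative terms pay for the last one: quasi-monotonicity makes the inner product worth
  \<open>\<mu> |z - xs|^2\<close>, and \<open>g - g'\<close> splits into the noise of \<open>g\<close>, the noise of \<open>g'\<close> and the drift
  \<open>F z - F y\<close>, which the Lipschitz bound controls by \<open>|z - x|\<close> and \<open>|x - y|\<close>.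

  The noise at a point chosen independently of the sampling vector has mean zero, and by the
  expected residual condition its second moment is at most \<open>\<delta> |point - xs|^2 + 2 \<sigma>^2\<close>. The
  descent estimate \<open>past_extragradient_descent\<close> is therefore stated pointwise, for deterministic
  vectors, with its three random corrections left explicit: one inner product of the newest noise
  with a quantity known beforehand, and two differences between a squared noise and its bound.
  In expectation the first vanishes and the other two are nonpositive, so that
  \<open>R' \<le> (1 - \<omega> \<mu> / 2) R + 12 \<omega>^2 \<sigma>^2\<close>; iterating this gives the linear rate, and
  \<open>24 \<omega> \<sigma>^2 / \<mu>\<close> is the fixed point of the recursion.

  The two noises need different independence statements. The point \<open>z\<close> at step \<open>k\<close> already
  depends on the vector with index \<open>k - 1\<close> and is independent only of the vector with index \<open>k\<close>;
  the point \<open>y\<close>, at which the vector with index \<open>k - 1\<close> is used, depends only on vectors with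
  smaller indices. This is \<open>iterates_determined_by_past\<close>; it is combined with Fubini's theorem in
  \<open>sampling_noise_at_independent_point\<close> and \<open>sampling_noise_orthogonal_to_past\<close>.

  For the complexity bound, the factor in front of the logarithm is exactly \<open>2 / (\<omega> \<mu>)\<close> for the
  prescribed \<open>\<omega>\<close>, so the decaying term is at most \<open>\<epsilon> / 2\<close>; the third bound on \<open>\<omega>\<close> makes the
  constant term at most \<open>\<epsilon> / 2\<close>.
\<close>

section \<open>Real sequences contracted up to a constant error\<close>

lemma le_geometric_plus_fixed_point:
  fixes R :: "nat \<Rightarrow> real"
  assumes step: "\<And>k. R (Suc k) \<le> q * R k + b" and q: "0 \<le> q" and B: "0 \<le> B" "q * B + b \<le> B"
  shows "R k \<le> q ^ k * R 0 + B"
proof (induction k)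
  case (Suc k)
  have "R (Suc k) \<le> q * (q ^ k * R 0 + B) + b"
    using step[of k] mult_left_mono[OF Suc q] by linarith
  then show ?case
    using B(2) by (simp add: algebra_simps)
qed (use B in simp)

text \<open>This is \<open>1 - \<eta> \<le> exp (- \<eta>)\<close> raised to the power \<open>K\<close>. The case \<open>a = 0\<close>, in
  which \<open>ln (a / e)\<close> takes the default value 0, is trivial and treated apart.\<close>
lemma geometric_le_after:
  fixes \<eta> a e :: real
  assumes \<eta>: "0 < \<eta>" "\<eta> \<le> 1" and "0 \<le> a" "0 < e" and K: "real K \<ge> ln (a / e) / \<eta>"
  shows "(1 - \<eta>) ^ K * a \<le> e"
proof (cases "a = 0")
  case False
  then have a: "0 < a" using assms by simp
  have "(1 - \<eta>) ^ K \<le> exp (- \<eta>) ^ K"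
    using \<eta> exp_ge_add_one_self[of "- \<eta>"] by (intro power_mono) auto
  also have "\<dots> = exp (- (\<eta> * real K))"
    by (simp add: exp_of_nat_mult[symmetric] mult.commute)
  also have "\<dots> \<le> exp (- ln (a / e))"
    using K \<eta> by (simp add: field_simps)
  also have "\<dots> = e / a"
    using a \<open>0 < e\<close> by (simp add: exp_minus)
  finally show ?thesis
    using a by (simp add: field_simps)
qed (use assms in simp)

text \<open>The number of steps needed at rate \<open>a * c / 2\<close> scales as \<open>2 / (a * c)\<close>: a minimum of
  admissible step sizes becomes a maximum of iteration counts.\<close>
lemma two_over_min:
  fixes a b c :: real
  assumes "0 < a" "0 < b" "0 < c"
  shows "2 / (min a b * c) = max (2 / (a * c)) (2 / (b * c))"
  using assms by (auto simp: min_def max_def field_simps)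

section \<open>One step in a real inner product space\<close>

lemma norm_add_sq_le: "(norm (a + b))\<^sup>2 \<le> 2 * (norm a)\<^sup>2 + 2 * (norm b)\<^sup>2" for a b :: "'a::real_inner"
  using zero_le_power2[of "norm (a - b)"]
  by (simp add: power2_norm_eq_inner inner_add_left inner_add_right inner_diff_left
      inner_diff_right inner_commute)

lemma norm_diff_sq_le: "(norm (a - b))\<^sup>2 \<le> 2 * (norm a)\<^sup>2 + 2 * (norm b)\<^sup>2" for a b :: "'a::real_inner"
  using norm_add_sq_le[of a "- b"] by simp

text \<open>Replacing \<open>x\<close> by \<open>z + \<omega> g'\<close> in \<open>\<langle>g, x - xs\<rangle>\<close> leaves a cross term \<open>\<langle>g, g'\<rangle>\<close> that completes
  the square \<open>|g - g'|^2\<close> at the price of \<open>\<omega>^2 |g'|^2 = |z - x|^2\<close>. This is how extrapolating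
  turns the size of \<open>g\<close> into the size of a difference.\<close>
lemma past_extragradient_identity:
  fixes x xs g g' :: "'a::real_inner"
  assumes "z = x - \<omega> *\<^sub>R g'" and "x' = x - \<omega> *\<^sub>R g"
  shows "(norm (x' - xs))\<^sup>2 + (norm (x' - z))\<^sup>2
         = (norm (x - xs))\<^sup>2 - (norm (z - x))\<^sup>2 - 2 * \<omega> * inner g (z - xs)
           + 2 * \<omega>\<^sup>2 * (norm (g - g'))\<^sup>2"
  unfolding assms power2_norm_eq_inner
  by (simp add: inner_diff_left inner_diff_right inner_commute algebra_simps power2_eq_square)

text \<open>
  Here \<open>Fy\<close> and \<open>Fz\<close> are the mean operator at \<open>y\<close> and \<open>z\<close>, and \<open>n'\<close> and \<open>n\<close> the noises added to
  them. The last three summands are the ones that disappear in expectation. The constants balance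
  exactly: after moving everything to \<open>x - xs\<close>, monotonicity less the noise bound at \<open>z\<close>
  contributes a decrease of \<open>17/18 \<omega> \<mu>\<close> and the noise bound at \<open>y\<close> an increase of
  \<open>8/18 \<omega> \<mu>\<close>, and the difference is the rate \<open>\<omega> \<mu> / 2\<close>. The drift of the operator is absorbed by \<open>|z - x|^2\<close> and \<open>|x - y|^2\<close>,
  because \<open>\<omega> L \<le> 1/4\<close>.
\<close>
lemma past_extragradient_descent:
  fixes x xs y z x' Fy Fz n n' :: "'a::real_inner"
  assumes z: "z = x - \<omega> *\<^sub>R (Fy + n')" and x': "x' = x - \<omega> *\<^sub>R (Fz + n)"
    and mono: "\<mu> * (norm (z - xs))\<^sup>2 \<le> inner Fz (z - xs)"
    and lip: "norm (Fz - Fy) \<le> L * norm (z - y)"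
    and pos: "0 < \<omega>" "0 < \<mu>" and \<mu>L: "\<mu> \<le> L" and \<omega>L: "\<omega> * L \<le> 1 / 4"
    and \<omega>\<delta>: "\<omega> * \<delta> \<le> \<mu> / 18"
  shows "(norm (x' - xs))\<^sup>2 + (norm (x' - z))\<^sup>2
     \<le> (1 - \<omega> * \<mu> / 2) * ((norm (x - xs))\<^sup>2 + (norm (x - y))\<^sup>2) + 12 * \<omega>\<^sup>2 * s
       + inner n ((4 * \<omega>\<^sup>2) *\<^sub>R (Fz - (Fy + n')) - (2 * \<omega>) *\<^sub>R (z - xs))
       + 2 * \<omega>\<^sup>2 * ((norm n)\<^sup>2 - (\<delta> * (norm (z - xs))\<^sup>2 + 2 * s))
       + 4 * \<omega>\<^sup>2 * ((norm n')\<^sup>2 - (\<delta> * (norm (y - xs))\<^sup>2 + 2 * s))"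
proof -
  define X where "X = (norm (x - xs))\<^sup>2"
  define W where "W = (norm (x - y))\<^sup>2"
  define Z where "Z = (norm (z - xs))\<^sup>2"
  define V where "V = (norm (z - x))\<^sup>2"
  define Y where "Y = (norm (y - xs))\<^sup>2"
  define Q where "Q = (norm (z - y))\<^sup>2"
  define c where "c = \<omega> * \<mu>"
  note defs = X_def W_def Z_def V_def Y_def Q_def
  have nonneg: "0 \<le> X" "0 \<le> W" "0 \<le> Z" "0 \<le> V" "0 \<le> Y" "0 \<le> Q"
    by (simp_all add: defs)
  have c: "0 \<le> c" "c \<le> 1 / 4"
    using pos order_trans[OF mult_left_mono[OF \<mu>L, of \<omega>] \<omega>L] by (simp_all add: c_def)
  have \<omega>2L2: "\<omega>\<^sup>2 * L\<^sup>2 \<le> 1 / 16"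
    using power_mono[OF \<omega>L, of 2] pos \<mu>L by (simp add: power_mult_distrib power_divide)
  have \<omega>2\<delta>: "\<omega>\<^sup>2 * \<delta> \<le> c / 18"
    using mult_left_mono[OF \<omega>\<delta>, of \<omega>] pos by (simp add: c_def power2_eq_square mult_ac)

  have triangles: "Q \<le> 2 * V + 2 * W" "Y \<le> 2 * X + 2 * W" "X \<le> 2 * Z + 2 * V"
    using norm_add_sq_le[of "z - x" "x - y"] norm_diff_sq_le[of "x - xs" "x - y"]
      norm_diff_sq_le[of "z - xs" "z - x"]
    by (simp_all add: defs)

  (* The cross term with n is kept as it is: it is not small, but it has expectation zero. *)
  have noise: "(norm (Fz + n - (Fy + n')))\<^sup>2
      = (norm n)\<^sup>2 + 2 * inner n (Fz - (Fy + n')) + (norm (Fz - (Fy + n')))\<^sup>2"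
    unfolding power2_norm_eq_inner
    by (simp add: inner_diff_left inner_diff_right inner_add_left inner_add_right inner_commute)
  have "(norm (Fz - Fy))\<^sup>2 \<le> L\<^sup>2 * Q"
    using power_mono[OF lip, of 2] by (simp add: Q_def power_mult_distrib)
  with norm_diff_sq_le[of "Fz - Fy" n']
  have drift: "(norm (Fz - (Fy + n')))\<^sup>2 \<le> 2 * (L\<^sup>2 * Q) + 2 * (norm n')\<^sup>2"
    by (simp add: diff_diff_eq)

  have "(norm (x' - xs))\<^sup>2 + (norm (x' - z))\<^sup>2
      = X - V - 2 * \<omega> * inner (Fz + n) (z - xs) + 2 * \<omega>\<^sup>2 * (norm (Fz + n - (Fy + n')))\<^sup>2"
    unfolding X_def V_def using past_extragradient_identity[OF z x'] .
  also have "\<dots> = X - V - 2 * \<omega> * inner Fz (z - xs) + 2 * \<omega>\<^sup>2 * (norm (Fz - (Fy + n')))\<^sup>2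
      + inner n ((4 * \<omega>\<^sup>2) *\<^sub>R (Fz - (Fy + n')) - (2 * \<omega>) *\<^sub>R (z - xs)) + 2 * \<omega>\<^sup>2 * (norm n)\<^sup>2"
    unfolding noise inner_diff_right[of n "_ *\<^sub>R _"] inner_scaleR_right inner_add_left
    by (simp add: algebra_simps)
  finally have expansion: "(norm (x' - xs))\<^sup>2 + (norm (x' - z))\<^sup>2 = \<dots>" .

  have "2 * \<omega> * (\<mu> * Z) \<le> 2 * \<omega> * inner Fz (z - xs)"
    using mono pos by (intro mult_left_mono) (simp_all add: Z_def)
  then have gain: "2 * (c * Z) \<le> 2 * \<omega> * inner Fz (z - xs)"
    by (simp add: c_def mult_ac)
  have loss: "2 * \<omega>\<^sup>2 * (norm (Fz - (Fy + n')))\<^sup>2 \<le> Q / 4 + 4 * \<omega>\<^sup>2 * (norm n')\<^sup>2"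
    using mult_left_mono[OF drift, of "2 * \<omega>\<^sup>2"] mult_right_mono[OF \<omega>2L2 nonneg(6)]
    by (simp add: algebra_simps)
  have residual: "2 * \<omega>\<^sup>2 * (\<delta> * Z) + 4 * \<omega>\<^sup>2 * (\<delta> * Y) \<le> c * Z / 9 + 2 / 9 * (c * Y)"
    using mult_right_mono[OF \<omega>2\<delta> nonneg(3)] mult_right_mono[OF \<omega>2\<delta> nonneg(5)]
    by (simp add: algebra_simps)
  have products: "c * Y \<le> 2 * (c * X) + 2 * (c * W)" "c * X \<le> 2 * (c * Z) + 2 * (c * V)"
    "c * V \<le> V / 4" "c * W \<le> W / 4"
    using mult_left_mono[OF triangles(2) c(1)] mult_left_mono[OF triangles(3) c(1)]
      mult_right_mono[OF c(2) nonneg(4)] mult_right_mono[OF c(2) nonneg(2)]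
    by (simp_all add: algebra_simps)
  have "X - V - 2 * (c * Z) + Q / 4 + c * Z / 9 + 2 / 9 * (c * Y) \<le> (1 - c / 2) * (X + W)"
  proof -
    have "(1 - c / 2) * (X + W) = X + W - (c * X) / 2 - (c * W) / 2"
      by (simp add: algebra_simps)
    with triangles(1) products nonneg show ?thesis by linarith
  qed
  with gain loss residual expansion show ?thesis
    unfolding X_def[symmetric] W_def[symmetric] Z_def[symmetric] Y_def[symmetric] c_def[symmetric]
    by (simp add: algebra_simps)
qed

section \<open>Square-integrable random vectors\<close>

definition square_integrable :: "'a measure \<Rightarrow> ('a \<Rightarrow> 'b::euclidean_space) \<Rightarrow> bool" where
  "square_integrable M X \<longleftrightarrow> X \<in> borel_measurable M \<and> integrable M (\<lambda>w. (norm (X w))\<^sup>2)"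

lemma square_integrable_integrable:
  "square_integrable M X \<Longrightarrow> integrable M (\<lambda>w. (norm (X w))\<^sup>2)"
  by (simp add: square_integrable_def)

lemma square_integrable_const: "finite_measure M \<Longrightarrow> square_integrable M (\<lambda>_. c)"
  by (simp add: square_integrable_def finite_measure.integrable_const)

lemma square_integrable_scaleR:
  assumes "square_integrable M X"
  shows "square_integrable M (\<lambda>w. c *\<^sub>R X w)"
  using assms by (auto simp: square_integrable_def power_mult_distrib)

lemma square_integrable_bounded:
  assumes X[measurable]: "X \<in> borel_measurable M" and Y: "square_integrable M Y"
    and le: "\<And>w. norm (X w) \<le> C * norm (Y w)"
  shows "square_integrable M X"
  unfolding square_integrable_def
proof (intro conjI X)
  have "(norm (X w))\<^sup>2 \<le> C\<^sup>2 * (norm (Y w))\<^sup>2" for w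
    using power_mono[OF le norm_ge_zero, of w 2] by (simp add: power_mult_distrib)
  moreover have "integrable M (\<lambda>w. C\<^sup>2 * (norm (Y w))\<^sup>2)"
    using Y by (simp add: square_integrable_def)
  ultimately show "integrable M (\<lambda>w. (norm (X w))\<^sup>2)"
    by (elim Bochner_Integration.integrable_bound) simp_all
qed

lemma square_integrable_add:
  assumes X: "square_integrable M X" and Y: "square_integrable M Y"
  shows "square_integrable M (\<lambda>w. X w + Y w)"
  unfolding square_integrable_def
proof
  have [measurable]: "X \<in> borel_measurable M" "Y \<in> borel_measurable M"
    using X Y by (simp_all add: square_integrable_def)
  show "(\<lambda>w. X w + Y w) \<in> borel_measurable M" by measurable
  have "integrable M (\<lambda>w. 2 * (norm (X w))\<^sup>2 + 2 * (norm (Y w))\<^sup>2)"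
    using X Y by (simp add: square_integrable_def)
  then show "integrable M (\<lambda>w. (norm (X w + Y w))\<^sup>2)"
    by (rule Bochner_Integration.integrable_bound) (simp_all add: norm_add_sq_le)
qed

lemma square_integrable_diff:
  assumes "square_integrable M X" "square_integrable M Y"
  shows "square_integrable M (\<lambda>w. X w - Y w)"
  using square_integrable_add[OF assms(1) square_integrable_scaleR[OF assms(2), of "-1"]] by simp

lemma square_integrable_inner:
  assumes X: "square_integrable M X" and Y: "square_integrable M Y"
  shows "integrable M (\<lambda>w. inner (X w) (Y w))"
proof -
  have [measurable]: "X \<in> borel_measurable M" "Y \<in> borel_measurable M"
    using X Y by (simp_all add: square_integrable_def)
  have "\<bar>inner (X w) (Y w)\<bar> \<le> (norm (X w))\<^sup>2 + (norm (Y w))\<^sup>2" for w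
  proof -
    have "\<bar>inner (X w) (Y w)\<bar> \<le> norm (X w) * norm (Y w)"
      by (rule Cauchy_Schwarz_ineq2)
    also have "\<dots> \<le> (norm (X w))\<^sup>2 + (norm (Y w))\<^sup>2"
      using sum_squares_bound[of "norm (X w)" "norm (Y w)"]
        mult_nonneg_nonneg[OF norm_ge_zero[of "X w"] norm_ge_zero[of "Y w"]] by linarith
    finally show ?thesis .
  qed
  moreover have "integrable M (\<lambda>w. (norm (X w))\<^sup>2 + (norm (Y w))\<^sup>2)"
    using X Y by (simp add: square_integrable_def)
  ultimately show ?thesis
    by (elim Bochner_Integration.integrable_bound) simp_all
qed

section \<open>Integration against an independent variable\<close>

context prob_space
begin

text \<open>
  The past of the iteration and the next sampling vector take values in different spaces, while
  \<open>indep_var\<close> relates variables with values in one type. Independence is therefore expressed by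
  the joint law being the product of the marginal laws, which is also the form that Fubini's
  theorem uses.
\<close>
definition independent :: "'b measure \<Rightarrow> ('a \<Rightarrow> 'b) \<Rightarrow> 'c measure \<Rightarrow> ('a \<Rightarrow> 'c) \<Rightarrow> bool" where
  "independent N P T U \<longleftrightarrow> P \<in> measurable M N \<and> U \<in> measurable M T \<and>
     distr M (N \<Otimes>\<^sub>M T) (\<lambda>w. (P w, U w)) = distr M N P \<Otimes>\<^sub>M distr M T U"

text \<open>The next two lemmas play the role of conditioning on \<open>P\<close>: given \<open>P\<close>, the law of \<open>U\<close> is
  unchanged, so the expectation can be taken over a fresh copy of \<open>U\<close> first.\<close>
lemma nn_integral_independent:
  assumes ind: "independent N P T U" and [measurable]: "case_prod f \<in> borel_measurable (N \<Otimes>\<^sub>M T)"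
  shows "(\<integral>\<^sup>+w. f (P w) (U w) \<partial>M) = (\<integral>\<^sup>+w. (\<integral>\<^sup>+u. f (P w) u \<partial>distr M T U) \<partial>M)"
proof -
  have [measurable]: "P \<in> measurable M N" "U \<in> measurable M T"
    using ind by (auto simp: independent_def)
  interpret U: prob_space "distr M T U" by (rule prob_space_distr) simp
  have "(\<integral>\<^sup>+w. f (P w) (U w) \<partial>M) = (\<integral>\<^sup>+q. case_prod f q \<partial>distr M (N \<Otimes>\<^sub>M T) (\<lambda>w. (P w, U w)))"
    by (subst nn_integral_distr) auto
  also have "\<dots> = (\<integral>\<^sup>+q. case_prod f q \<partial>(distr M N P \<Otimes>\<^sub>M distr M T U))"
    using ind by (simp add: independent_def)
  also have "\<dots> = (\<integral>\<^sup>+p. (\<integral>\<^sup>+u. f p u \<partial>distr M T U) \<partial>distr M N P)"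
    by (subst U.nn_integral_fst[symmetric]) (simp_all cong: measurable_cong_sets)
  also have "\<dots> = (\<integral>\<^sup>+w. (\<integral>\<^sup>+u. f (P w) u \<partial>distr M T U) \<partial>M)"
    by (subst nn_integral_distr) auto
  finally show ?thesis .
qed

lemma integral_independent:
  fixes f :: "'b \<Rightarrow> 'c \<Rightarrow> real"
  assumes ind: "independent N P T U" and [measurable]: "case_prod f \<in> borel_measurable (N \<Otimes>\<^sub>M T)"
    and int: "integrable M (\<lambda>w. f (P w) (U w))"
  shows "(\<integral>w. f (P w) (U w) \<partial>M) = (\<integral>w. (\<integral>u. f (P w) u \<partial>distr M T U) \<partial>M)"
proof -
  have [measurable]: "P \<in> measurable M N" "U \<in> measurable M T"
    using ind by (auto simp: independent_def)
  interpret U: prob_space "distr M T U" by (rule prob_space_distr) simp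
  interpret P: prob_space "distr M N P" by (rule prob_space_distr) simp
  interpret PU: pair_prob_space "distr M N P" "distr M T U" ..
  have eq: "distr M (N \<Otimes>\<^sub>M T) (\<lambda>w. (P w, U w)) = distr M N P \<Otimes>\<^sub>M distr M T U"
    using ind by (simp add: independent_def)
  have int': "integrable (distr M N P \<Otimes>\<^sub>M distr M T U) (case_prod f)"
    unfolding eq[symmetric] using int by (subst integrable_distr_eq) auto
  have "(\<integral>w. f (P w) (U w) \<partial>M) = (\<integral>q. case_prod f q \<partial>distr M (N \<Otimes>\<^sub>M T) (\<lambda>w. (P w, U w)))"
    by (subst integral_distr) auto
  also have "\<dots> = (\<integral>p. (\<integral>u. f p u \<partial>distr M T U) \<partial>distr M N P)"
    unfolding eq using PU.integral_fst'[OF int'] by simp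
  also have "\<dots> = (\<integral>w. (\<integral>u. f (P w) u \<partial>distr M T U) \<partial>M)"
    by (subst integral_distr) auto
  finally show ?thesis .
qed

text \<open>
  A functional \<open>\<phi>\<close> of the whole family that reads only the coordinates in \<open>A\<close> factors through the
  restriction to \<open>A\<close>. The restrictions to \<open>A\<close> and to \<open>{i}\<close> are independent as elements of
  product spaces, and the product law is pushed forward by \<open>\<phi>\<close> and by evaluation at \<open>i\<close>.
\<close>
lemma independent_coordinate:
  assumes X: "indep_vars (\<lambda>_. N) X I" and AI: "A \<subseteq> I" "i \<in> I" "i \<notin> A"
    and \<phi>[measurable]: "\<phi> \<in> measurable (PiM A (\<lambda>_. N)) S"
    and restr: "\<And>p. \<phi> (restrict p A) = \<phi> p"
  shows "independent S (\<lambda>w. \<phi> (\<lambda>j. X j w)) N (X i)"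
proof -
  let ?P = "\<lambda>w. restrict (\<lambda>j. X j w) A" and ?Q = "\<lambda>w. restrict (\<lambda>j. X j w) {i}"
  let ?A = "PiM A (\<lambda>_. N)" and ?B = "PiM {i} (\<lambda>_. N)"
  have "indep_var ?A ?P ?B ?Q"
    using assms by (intro indep_var_restrict) auto
  then have [measurable]: "?P \<in> measurable M ?A" "?Q \<in> measurable M ?B"
    and joint: "distr M ?A ?P \<Otimes>\<^sub>M distr M ?B ?Q = distr M (?A \<Otimes>\<^sub>M ?B) (\<lambda>w. (?P w, ?Q w))"
    by (simp_all add: indep_var_distribution_eq)
  have [measurable]: "(\<lambda>q. q i) \<in> measurable ?B N"
    by (rule measurable_component_singleton) simp
  have past: "(\<lambda>w. \<phi> (\<lambda>j. X j w)) = (\<lambda>w. \<phi> (?P w))"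
    by (simp add: restr)
  have [measurable]: "X i \<in> measurable M N"
    using X AI by (auto simp: indep_vars_def)
  have [measurable]: "(\<lambda>w. \<phi> (?P w)) \<in> measurable M S" "(\<lambda>w. ?Q w i) \<in> measurable M N"
    by measurable
  interpret Q: prob_space "distr (distr M ?B ?Q) N (\<lambda>q. q i)"
    by (intro prob_space.prob_space_distr prob_space_distr) simp_all
  have "distr M S (\<lambda>w. \<phi> (?P w)) \<Otimes>\<^sub>M distr M N (\<lambda>w. ?Q w i)
      = distr (distr M ?A ?P) S \<phi> \<Otimes>\<^sub>M distr (distr M ?B ?Q) N (\<lambda>q. q i)"
    by (simp add: distr_distr comp_def)
  also have "\<dots> = distr (distr M ?A ?P \<Otimes>\<^sub>M distr M ?B ?Q) (S \<Otimes>\<^sub>M N) (\<lambda>(p, q). (\<phi> p, q i))"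
    by (intro pair_measure_distr) (simp_all add: Q.sigma_finite_measure_axioms)
  also have "\<dots> = distr M (S \<Otimes>\<^sub>M N) (\<lambda>w. (\<phi> (?P w), ?Q w i))"
    unfolding joint by (subst distr_distr) (auto simp: comp_def)
  finally show ?thesis
    unfolding independent_def past by simp
qed

end

section \<open>Sampling noise and its moments\<close>

locale speg = prob_space M for M :: "'w measure" +
  fixes Fs :: "'n::finite \<Rightarrow> real^'d \<Rightarrow> real^'d"
    and D :: "(real^'n) measure"
    and v :: "int \<Rightarrow> 'w \<Rightarrow> real^'n"
    and x0 xs :: "real^'d"
    and L \<mu> \<delta> :: real
  assumes Fs_measurable [measurable]: "\<And>i. Fs i \<in> borel_measurable borel"
    and lipschitz: "L-lipschitz_on UNIV (mean_op Fs)"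
    and monotone: "quasi_strongly_monotone \<mu> (mean_op Fs) xs"
    and sampling: "sampling_distribution D"
    and \<delta>_pos: "0 < \<delta>"
    and residual: "expected_residual \<delta> D Fs xs"
    and noise_integrable: "integrable D (\<lambda>u. (norm (stoch_op Fs u xs))\<^sup>2)"
    and v_indep: "indep_vars (\<lambda>_. borel) v {-1..}"
    and v_distr: "\<And>j. j \<ge> -1 \<Longrightarrow> distr M borel (v j) = D"
begin

abbreviation F :: "real^'d \<Rightarrow> real^'d" where "F \<equiv> mean_op Fs"

abbreviation \<sigma>2 :: real where "\<sigma>2 \<equiv> noise_at_solution D Fs xs"

definition sampling_noise :: "real^'n \<Rightarrow> real^'d \<Rightarrow> real^'d" where
  "sampling_noise u x = stoch_op Fs u x - F x"

lemma stoch_op_eq: "stoch_op Fs u x = F x + sampling_noise u x"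
  by (simp add: sampling_noise_def)

lemma F_solution: "F xs = 0"
  and \<mu>_pos: "0 < \<mu>"
  and F_monotone: "\<mu> * (norm (x - xs))\<^sup>2 \<le> inner (F x) (x - xs)"
  using monotone by (auto simp: quasi_strongly_monotone_def)

lemma F_lipschitz: "norm (F x - F y) \<le> L * norm (x - y)"
  using lipschitz_onD[OF lipschitz, of x y] by (simp add: dist_norm)

text \<open>Along a unit vector, monotonicity forces \<open>F\<close> to grow at least at rate \<open>\<mu>\<close> and the Lipschitz
  condition at most at rate \<open>L\<close>. In particular \<open>L\<close> is positive, so that \<open>1 / (4 * L)\<close> is a
  genuine bound on the step size rather than a division by zero.\<close>
lemma \<mu>_le_L: "\<mu> \<le> L"
proof -
  define e :: "real^'d" where "e = axis undefined 1"
  have "\<mu> = \<mu> * (norm (xs + e - xs))\<^sup>2"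
    by (simp add: e_def norm_axis_1)
  also have "\<dots> \<le> inner (F (xs + e)) e"
    using F_monotone[of "xs + e"] by simp
  also have "\<dots> \<le> norm (F (xs + e)) * norm e"
    by (rule norm_cauchy_schwarz)
  also have "\<dots> \<le> L"
    using F_lipschitz[of "xs + e" xs] by (simp add: e_def norm_axis_1 F_solution)
  finally show ?thesis .
qed

lemma \<sigma>2_nonneg: "0 \<le> \<sigma>2"
  by (simp add: noise_at_solution_def)

lemma prob_space_D: "prob_space D"
  and sets_D [measurable_cong]: "sets D = sets borel"
  using sampling by (auto simp: sampling_distribution_def)

lemma v_measurable [measurable]: "j \<ge> -1 \<Longrightarrow> v j \<in> borel_measurable M"
  using v_indep by (auto simp: indep_vars_def)

lemma F_measurable [measurable]: "F \<in> borel_measurable borel"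
proof -
  have "F = (\<lambda>x. (1 / real CARD('n)) *\<^sub>R (\<Sum>i\<in>UNIV. Fs i x))"
    by (simp add: mean_op_def fun_eq_iff)
  then show ?thesis by simp
qed

lemma vec_nth_measurable [measurable]: "(\<lambda>u::real^'n. u $ i) \<in> borel_measurable borel"
  by (intro borel_measurable_continuous_onI continuous_intros)

lemma stoch_op_measurable [measurable]:
  assumes [measurable]: "f \<in> borel_measurable N" "g \<in> borel_measurable N"
  shows "(\<lambda>w. stoch_op Fs (f w) (g w)) \<in> borel_measurable N"
  unfolding stoch_op_def by measurable

lemma sampling_noise_measurable [measurable]:
  assumes [measurable]: "f \<in> borel_measurable N" "g \<in> borel_measurable N"
  shows "(\<lambda>w. sampling_noise (f w) (g w)) \<in> borel_measurable N"
  unfolding sampling_noise_def by measurable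

lemma sampling_noise_mean_zero:
  "integrable D (\<lambda>u. sampling_noise u x)" "(\<integral>u. sampling_noise u x \<partial>D) = 0"
proof -
  interpret D: prob_space D by (rule prob_space_D)
  have coord: "integrable D (\<lambda>u. u $ i)" "(\<integral>u. u $ i \<partial>D) = 1" for i
    using sampling by (auto simp: sampling_distribution_def)
  have int: "integrable D (\<lambda>u. stoch_op Fs u x)"
    unfolding stoch_op_def using coord by simp
  then show "integrable D (\<lambda>u. sampling_noise u x)"
    unfolding sampling_noise_def by simp
  have "(\<integral>u. stoch_op Fs u x \<partial>D) = F x"
    unfolding stoch_op_def mean_op_def using coord by simp
  then show "(\<integral>u. sampling_noise u x \<partial>D) = 0"
    unfolding sampling_noise_def using int D.prob_space by simp
qed

text \<open>Since \<open>F xs = 0\<close>, the noise at \<open>x\<close> is the sum of the residual that the expected residual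
  condition bounds and of the stochastic operator at \<open>xs\<close>, whose second moment is \<open>\<sigma>2\<close>.\<close>
lemma sampling_noise_second_moment:
  "integrable D (\<lambda>u. (norm (sampling_noise u x))\<^sup>2)"
  "(\<integral>u. (norm (sampling_noise u x))\<^sup>2 \<partial>D) \<le> \<delta> * (norm (x - xs))\<^sup>2 + 2 * \<sigma>2"
proof -
  let ?r = "\<lambda>u. (norm ((stoch_op Fs u x - stoch_op Fs u xs) - (F x - F xs)))\<^sup>2"
  let ?b = "\<lambda>u. 2 * ?r u + 2 * (norm (stoch_op Fs u xs))\<^sup>2"
  have r: "integrable D ?r" "(\<integral>u. ?r u \<partial>D) \<le> \<delta> / 2 * (norm (x - xs))\<^sup>2"
    using residual by (auto simp: expected_residual_def)
  have b: "integrable D ?b"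
    using r(1) noise_integrable by simp
  have le: "(norm (sampling_noise u x))\<^sup>2 \<le> ?b u" for u
    using norm_add_sq_le[of "(stoch_op Fs u x - stoch_op Fs u xs) - (F x - F xs)" "stoch_op Fs u xs"]
    by (simp add: sampling_noise_def F_solution)
  show int: "integrable D (\<lambda>u. (norm (sampling_noise u x))\<^sup>2)"
    using le by (intro Bochner_Integration.integrable_bound[OF b]) auto
  have "(\<integral>u. (norm (sampling_noise u x))\<^sup>2 \<partial>D) \<le> (\<integral>u. ?b u \<partial>D)"
    using le by (intro integral_mono int b)
  also have "\<dots> = 2 * (\<integral>u. ?r u \<partial>D) + 2 * \<sigma>2"
    using r(1) noise_integrable by (simp add: noise_at_solution_def)
  finally show "(\<integral>u. (norm (sampling_noise u x))\<^sup>2 \<partial>D) \<le> \<delta> * (norm (x - xs))\<^sup>2 + 2 * \<sigma>2"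
    using r(2) by simp
qed

text \<open>
  The second-moment bound at a fixed point carries over to a random point by averaging over the
  sampling vector first. The argument runs through the nonnegative integral, because
  integrability of the squared noise is part of the conclusion.
\<close>
lemma sampling_noise_at_independent_point:
  assumes ind: "independent borel Z borel (v j)" and j: "j \<ge> -1"
    and Z: "square_integrable M (\<lambda>w. Z w - xs)"
  shows "square_integrable M (\<lambda>w. sampling_noise (v j w) (Z w))"
    and "expectation (\<lambda>w. (norm (sampling_noise (v j w) (Z w)))\<^sup>2)
         \<le> expectation (\<lambda>w. \<delta> * (norm (Z w - xs))\<^sup>2 + 2 * \<sigma>2)"
proof -
  note v_measurable[OF j, measurable]
  have [measurable]: "Z \<in> borel_measurable M"
    using ind by (simp add: independent_def)
  let ?q = "\<lambda>w. (norm (sampling_noise (v j w) (Z w)))\<^sup>2" and ?b = "\<lambda>z. \<delta> * (norm (z - xs))\<^sup>2 + 2 * \<sigma>2"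
  have b_nonneg: "0 \<le> ?b z" for z
    using \<delta>_pos \<sigma>2_nonneg by simp
  have b: "integrable M (\<lambda>w. ?b (Z w))"
    using square_integrable_integrable[OF Z] by simp
  have "(\<integral>\<^sup>+w. ennreal (?q w) \<partial>M)
      = (\<integral>\<^sup>+w. (\<integral>\<^sup>+u. ennreal ((norm (sampling_noise u (Z w)))\<^sup>2) \<partial>distr M borel (v j)) \<partial>M)"
    by (rule nn_integral_independent[OF ind]) measurable
  also have "\<dots> \<le> (\<integral>\<^sup>+w. ennreal (?b (Z w)) \<partial>M)"
  proof (intro nn_integral_mono)
    fix w
    have "(\<integral>\<^sup>+u. ennreal ((norm (sampling_noise u (Z w)))\<^sup>2) \<partial>D) = ennreal (\<integral>u. (norm (sampling_noise u (Z w)))\<^sup>2 \<partial>D)"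
      by (intro nn_integral_eq_integral sampling_noise_second_moment) simp
    then show "(\<integral>\<^sup>+u. ennreal ((norm (sampling_noise u (Z w)))\<^sup>2) \<partial>distr M borel (v j)) \<le> ennreal (?b (Z w))"
      using sampling_noise_second_moment(2)[of "Z w"] by (simp add: v_distr[OF j] ennreal_leI)
  qed
  also have "\<dots> = ennreal (expectation (\<lambda>w. ?b (Z w)))"
    using b_nonneg by (intro nn_integral_eq_integral b) simp
  finally have le: "(\<integral>\<^sup>+w. ennreal (?q w) \<partial>M) \<le> ennreal (expectation (\<lambda>w. ?b (Z w)))" .
  have int: "integrable M ?q"
    using le_less_trans[OF le ennreal_less_top] by (intro integrableI_nonneg) simp_all
  then show "square_integrable M (\<lambda>w. sampling_noise (v j w) (Z w))"
    by (simp add: square_integrable_def)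
  have "ennreal (expectation ?q) \<le> ennreal (expectation (\<lambda>w. ?b (Z w)))"
    using le nn_integral_eq_integral[OF int] by simp
  then show "expectation ?q \<le> expectation (\<lambda>w. ?b (Z w))"
    using b_nonneg by (subst (asm) ennreal_le_iff) (auto intro!: integral_nonneg)
qed

text \<open>\<open>Z\<close> and \<open>H\<close> have to be jointly independent of the sampling vector: only then are both fixed
  while the mean-zero noise is averaged.\<close>
lemma sampling_noise_orthogonal_to_past:
  assumes ind: "independent (borel \<Otimes>\<^sub>M borel) (\<lambda>w. (Z w, H w)) borel (v j)" and j: "j \<ge> -1"
    and sampling_noise: "square_integrable M (\<lambda>w. sampling_noise (v j w) (Z w))" and H: "square_integrable M H"
  shows "expectation (\<lambda>w. inner (sampling_noise (v j w) (Z w)) (H w)) = 0"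
proof -
  have "expectation (\<lambda>w. inner (sampling_noise (v j w) (Z w)) (H w))
      = expectation (\<lambda>w. \<integral>u. inner (sampling_noise u (Z w)) (H w) \<partial>D)"
    using integral_independent[OF ind, of "\<lambda>p u. inner (sampling_noise u (fst p)) (snd p)"]
      square_integrable_inner[OF sampling_noise H] by (simp add: v_distr[OF j])
  also have "\<dots> = 0"
    using sampling_noise_mean_zero by simp
  finally show ?thesis .
qed

section \<open>The iterates as functionals of the sampled path\<close>

abbreviation speg_iterate :: "real \<Rightarrow> nat \<Rightarrow> (int \<Rightarrow> real^'n) \<Rightarrow> real^'d" where
  "speg_iterate \<omega> k p \<equiv> speg_x (\<lambda>_. \<omega>) (\<lambda>_. \<omega>) Fs x0 p k"

text \<open>The index is that of the state, so \<open>extrapolation \<omega> k\<close> is the extrapolated point with index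
  \<open>k - 1\<close> in the usual numbering of the method.\<close>
abbreviation extrapolation :: "real \<Rightarrow> nat \<Rightarrow> (int \<Rightarrow> real^'n) \<Rightarrow> real^'d" where
  "extrapolation \<omega> k p \<equiv> speg_xhat_prev (\<lambda>_. \<omega>) (\<lambda>_. \<omega>) Fs x0 p k"

lemma initial_state: "speg_iterate \<omega> 0 p = x0" "extrapolation \<omega> 0 p = x0"
  by (simp_all add: speg_x_def speg_xhat_prev_def)

lemma extrapolation_Suc:
  "extrapolation \<omega> (Suc k) p
   = speg_iterate \<omega> k p - \<omega> *\<^sub>R stoch_op Fs (p (int k - 1)) (extrapolation \<omega> k p)"
  by (simp add: speg_x_def speg_xhat_prev_def case_prod_unfold Let_def)

lemma speg_iterate_Suc:
  "speg_iterate \<omega> (Suc k) p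
   = speg_iterate \<omega> k p - \<omega> *\<^sub>R stoch_op Fs (p (int k)) (extrapolation \<omega> (Suc k) p)"
  by (simp add: speg_x_def speg_xhat_prev_def case_prod_unfold Let_def)

text \<open>
  Measurability with respect to the product over \<open>A\<close> only concerns paths that are undefined
  outside \<open>A\<close>; the second condition says that on arbitrary paths the values outside \<open>A\<close> do not
  matter. Together they say that \<open>\<phi>\<close> is measurable with respect to the sigma-algebra generated
  by the coordinates in \<open>A\<close>.
\<close>
definition determined_by :: "int set \<Rightarrow> 's measure \<Rightarrow> ((int \<Rightarrow> real^'n) \<Rightarrow> 's) \<Rightarrow> bool" where
  "determined_by A S \<phi> \<longleftrightarrow>
     \<phi> \<in> measurable (PiM A (\<lambda>_. borel)) S \<and> (\<forall>p. \<phi> (restrict p A) = \<phi> p)"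

lemma determined_by_diff_stoch_op:
  assumes X: "determined_by A borel X" and Y: "determined_by A borel Y" and j: "j \<in> A"
  shows "determined_by A borel (\<lambda>p. X p - \<omega> *\<^sub>R stoch_op Fs (p j) (Y p))"
proof -
  have [measurable]: "X \<in> borel_measurable (PiM A (\<lambda>_. borel))"
    "Y \<in> borel_measurable (PiM A (\<lambda>_. borel))"
    using X Y by (simp_all add: determined_by_def)
  note measurable_component_singleton[OF j, measurable]
  have "X (restrict p A) - \<omega> *\<^sub>R stoch_op Fs (restrict p A j) (Y (restrict p A))
      = X p - \<omega> *\<^sub>R stoch_op Fs (p j) (Y p)" for p
    using X Y j by (simp add: determined_by_def)
  then show ?thesis
    unfolding determined_by_def by simp
qed

text \<open>
  The extrapolated point lags one index behind the iterate: the point with index \<open>k\<close>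
  reads sampling vectors only up to index \<open>k - 1\<close>. This lag is what makes it independent of
  the vector at which the operator is evaluated next. The two claims need each other
  in the induction.
\<close>
lemma iterates_determined_by_past:
  shows "{-1..<int k} \<subseteq> A \<Longrightarrow> determined_by A borel (speg_iterate \<omega> k)"
    and "{-1..<int k - 1} \<subseteq> A \<Longrightarrow> determined_by A borel (extrapolation \<omega> k)"
proof (induction k arbitrary: A)
  case 0
  { case 1 show ?case by (simp add: determined_by_def initial_state) }
  { case 2 show ?case by (simp add: determined_by_def initial_state) }
next
  case (Suc k)
  have hat: "determined_by A borel (extrapolation \<omega> (Suc k))" if A: "{-1..<int k} \<subseteq> A" for A
  proof -
    have "{-1..<int k - 1} \<subseteq> {-1..<int k}" "int k - 1 \<in> {-1..<int k}" by auto
    with A have "{-1..<int k - 1} \<subseteq> A" "int k - 1 \<in> A" by blast+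
    with A show ?thesis
      unfolding extrapolation_Suc by (intro determined_by_diff_stoch_op Suc.IH)
  qed
  { case 1
    have "{-1..<int k} \<subseteq> {-1..<int (Suc k)}" "int k \<in> {-1..<int (Suc k)}" by auto
    with 1 have "{-1..<int k} \<subseteq> A" "int k \<in> A" by blast+
    then show ?case
      unfolding speg_iterate_Suc by (intro determined_by_diff_stoch_op Suc.IH hat) }
  { case 2
    then show ?case by (intro hat) simp }
qed

lemma independent_of_past:
  assumes j: "j \<ge> -1" and \<phi>: "determined_by {-1..<j} S \<phi>"
  shows "independent S (\<lambda>w. \<phi> (\<lambda>i. v i w)) borel (v j)"
proof (rule independent_coordinate[OF v_indep])
  show "\<phi> \<in> measurable (PiM {-1..<j} (\<lambda>_. borel)) S"
    and "\<phi> (restrict p {-1..<j}) = \<phi> p" for p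
    using \<phi> unfolding determined_by_def by blast+
qed (use j in auto)

section \<open>The contraction of the expected squared error\<close>

lemma F_square_integrable:
  assumes Z: "square_integrable M (\<lambda>w. Z w - xs)"
  shows "square_integrable M (\<lambda>w. F (Z w))"
proof (rule square_integrable_bounded[OF _ Z])
  have "(\<lambda>w. (Z w - xs) + xs) \<in> borel_measurable M"
    using Z by (intro borel_measurable_add) (simp_all add: square_integrable_def)
  then have [measurable]: "Z \<in> borel_measurable M" by simp
  show "(\<lambda>w. F (Z w)) \<in> borel_measurable M" by measurable
  show "norm (F (Z w)) \<le> L * norm (Z w - xs)" for w
    using F_lipschitz[of "Z w" xs] by (simp add: F_solution)
qed

text \<open>
  The induction carries square integrability along with the contraction, because a bound
  on an integral says nothing unless the integrand is integrable. The hypotheses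
  concern \<open>x k - xs\<close> and \<open>x k - y k\<close>, whose squared norms are the two summands of the error.
\<close>
lemma speg_one_step:
  fixes \<omega> k
  defines "x \<equiv> \<lambda>i w. speg_iterate \<omega> i (\<lambda>j. v j w)"
    and "y \<equiv> \<lambda>i w. extrapolation \<omega> i (\<lambda>j. v j w)"
    and "R \<equiv> \<lambda>i. speg_R2 M (\<lambda>_. \<omega>) (\<lambda>_. \<omega>) Fs x0 v xs i"
  assumes \<omega>: "0 < \<omega>" "\<omega> * L \<le> 1 / 4" "\<omega> * \<delta> \<le> \<mu> / 18"
    and x: "square_integrable M (\<lambda>w. x k w - xs)"
    and xy: "square_integrable M (\<lambda>w. x k w - y k w)"
  shows "square_integrable M (\<lambda>w. x (Suc k) w - xs)"
    and "square_integrable M (\<lambda>w. x (Suc k) w - y (Suc k) w)"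
    and "R (Suc k) \<le> (1 - \<omega> * \<mu> / 2) * R k + 12 * \<omega>\<^sup>2 * \<sigma>2"
proof -
  define n' where "n' = (\<lambda>w. sampling_noise (v (int k - 1) w) (y k w))"
  define n where "n = (\<lambda>w. sampling_noise (v (int k) w) (y (Suc k) w))"
  define H where "H = (\<lambda>w. (4 * \<omega>\<^sup>2) *\<^sub>R (F (y (Suc k) w) - (F (y k w) + n' w))
                          - (2 * \<omega>) *\<^sub>R (y (Suc k) w - xs))"
  have y_Suc: "y (Suc k) w = x k w - \<omega> *\<^sub>R (F (y k w) + n' w)" for w
    by (simp add: x_def y_def n'_def extrapolation_Suc stoch_op_eq)
  have x_Suc: "x (Suc k) w = x k w - \<omega> *\<^sub>R (F (y (Suc k) w) + n w)" for w
    by (simp add: x_def y_def n_def speg_iterate_Suc stoch_op_eq)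

  have y: "square_integrable M (\<lambda>w. y k w - xs)"
    using square_integrable_diff[OF x xy] by simp
  have ind_y: "independent borel (y k) borel (v (int k - 1))"
    unfolding y_def by (intro independent_of_past iterates_determined_by_past) auto
  have n': "square_integrable M n'"
    and n'_le: "expectation (\<lambda>w. (norm (n' w))\<^sup>2) \<le> expectation (\<lambda>w. \<delta> * (norm (y k w - xs))\<^sup>2 + 2 * \<sigma>2)"
    unfolding n'_def using sampling_noise_at_independent_point[OF ind_y _ y] by auto
  have g': "square_integrable M (\<lambda>w. F (y k w) + n' w)"
    by (intro square_integrable_add F_square_integrable y n')
  have z: "square_integrable M (\<lambda>w. y (Suc k) w - xs)"
    using square_integrable_diff[OF x square_integrable_scaleR[OF g', of \<omega>]]
    by (simp add: y_Suc algebra_simps)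

  have ind_z: "independent borel (y (Suc k)) borel (v (int k))"
    unfolding y_def by (intro independent_of_past iterates_determined_by_past) auto
  have n: "square_integrable M n"
    and n_le: "expectation (\<lambda>w. (norm (n w))\<^sup>2) \<le> expectation (\<lambda>w. \<delta> * (norm (y (Suc k) w - xs))\<^sup>2 + 2 * \<sigma>2)"
    unfolding n_def using sampling_noise_at_independent_point[OF ind_z _ z] by auto
  have H: "square_integrable M H"
    unfolding H_def
    by (intro square_integrable_diff square_integrable_scaleR F_square_integrable z g')
  (* H contains the old noise n', hence the vector with index k - 1, but not the one with index k. *)
  have ind_zH: "independent (borel \<Otimes>\<^sub>M borel) (\<lambda>w. (y (Suc k) w, H w)) borel (v (int k))"
  proof -
    let ?A = "{-1..<int k}"
    let ?H = "\<lambda>p. (4 * \<omega>\<^sup>2) *\<^sub>R (F (extrapolation \<omega> (Suc k) p)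
        - stoch_op Fs (p (int k - 1)) (extrapolation \<omega> k p)) - (2 * \<omega>) *\<^sub>R (extrapolation \<omega> (Suc k) p - xs)"
    let ?\<phi> = "\<lambda>p. (extrapolation \<omega> (Suc k) p, ?H p)"
    have mem: "int k - 1 \<in> ?A" by auto
    have det: "determined_by ?A borel (extrapolation \<omega> k)"
      "determined_by ?A borel (extrapolation \<omega> (Suc k))"
      by (intro iterates_determined_by_past; force)+
    then have [measurable]: "extrapolation \<omega> k \<in> borel_measurable (PiM ?A (\<lambda>_. borel))"
      "extrapolation \<omega> (Suc k) \<in> borel_measurable (PiM ?A (\<lambda>_. borel))"
      unfolding determined_by_def by blast+
    note measurable_component_singleton[OF mem, measurable]
    have "?\<phi> (restrict p ?A) = ?\<phi> p" for p
    proof -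
      have "extrapolation \<omega> k (restrict p ?A) = extrapolation \<omega> k p"
        "extrapolation \<omega> (Suc k) (restrict p ?A) = extrapolation \<omega> (Suc k) p"
        "restrict p ?A (int k - 1) = p (int k - 1)"
        using det mem unfolding determined_by_def by auto
      then show ?thesis by (simp only:)
    qed
    moreover have "?\<phi> \<in> measurable (PiM ?A (\<lambda>_. borel)) (borel \<Otimes>\<^sub>M borel)" by measurable
    ultimately have "independent (borel \<Otimes>\<^sub>M borel) (\<lambda>w. ?\<phi> (\<lambda>j. v j w)) borel (v (int k))"
      by (intro independent_of_past) (auto simp only: determined_by_def)
    then show ?thesis
      by (simp add: H_def y_def n'_def stoch_op_eq)
  qed
  have orth: "expectation (\<lambda>w. inner (n w) (H w)) = 0"
    unfolding n_def using n H
    by (intro sampling_noise_orthogonal_to_past[OF ind_zH]) (simp_all add: n_def)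

  have g: "square_integrable M (\<lambda>w. F (y (Suc k) w) + n w)"
    by (intro square_integrable_add F_square_integrable z n)
  show x'_sq: "square_integrable M (\<lambda>w. x (Suc k) w - xs)"
    using square_integrable_diff[OF x square_integrable_scaleR[OF g, of \<omega>]]
    by (simp add: x_Suc algebra_simps)
  show xz_sq: "square_integrable M (\<lambda>w. x (Suc k) w - y (Suc k) w)"
    using square_integrable_diff[OF x'_sq z] by simp

  note int = square_integrable_integrable[OF x] square_integrable_integrable[OF xy]
    square_integrable_integrable[OF x'_sq] square_integrable_integrable[OF xz_sq]
    square_integrable_integrable[OF y] square_integrable_integrable[OF z]
    square_integrable_integrable[OF n] square_integrable_integrable[OF n']
    square_integrable_inner[OF n H]
  have R_eq: "R i = expectation (\<lambda>w. (norm (x i w - xs))\<^sup>2 + (norm (x i w - y i w))\<^sup>2)" for i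
    by (simp add: R_def x_def y_def speg_R2_def speg_sq_err_def)
  have "R (Suc k) \<le> expectation (\<lambda>w.
       (1 - \<omega> * \<mu> / 2) * ((norm (x k w - xs))\<^sup>2 + (norm (x k w - y k w))\<^sup>2) + 12 * \<omega>\<^sup>2 * \<sigma>2
       + inner (n w) (H w)
       + 2 * \<omega>\<^sup>2 * ((norm (n w))\<^sup>2 - (\<delta> * (norm (y (Suc k) w - xs))\<^sup>2 + 2 * \<sigma>2))
       + 4 * \<omega>\<^sup>2 * ((norm (n' w))\<^sup>2 - (\<delta> * (norm (y k w - xs))\<^sup>2 + 2 * \<sigma>2)))"
    unfolding R_eq
  proof (intro integral_mono)
    fix w
    show "(norm (x (Suc k) w - xs))\<^sup>2 + (norm (x (Suc k) w - y (Suc k) w))\<^sup>2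
      \<le> (1 - \<omega> * \<mu> / 2) * ((norm (x k w - xs))\<^sup>2 + (norm (x k w - y k w))\<^sup>2) + 12 * \<omega>\<^sup>2 * \<sigma>2
       + inner (n w) (H w)
       + 2 * \<omega>\<^sup>2 * ((norm (n w))\<^sup>2 - (\<delta> * (norm (y (Suc k) w - xs))\<^sup>2 + 2 * \<sigma>2))
       + 4 * \<omega>\<^sup>2 * ((norm (n' w))\<^sup>2 - (\<delta> * (norm (y k w - xs))\<^sup>2 + 2 * \<sigma>2))"
      unfolding H_def
      by (rule past_extragradient_descent[OF y_Suc x_Suc F_monotone F_lipschitz \<omega>(1) \<mu>_pos \<mu>_le_L \<omega>(2,3)])
  qed (use int in simp_all)
  also have "\<dots> = (1 - \<omega> * \<mu> / 2) * R k + 12 * \<omega>\<^sup>2 * \<sigma>2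
       + 2 * \<omega>\<^sup>2 * (expectation (\<lambda>w. (norm (n w))\<^sup>2) - expectation (\<lambda>w. \<delta> * (norm (y (Suc k) w - xs))\<^sup>2 + 2 * \<sigma>2))
       + 4 * \<omega>\<^sup>2 * (expectation (\<lambda>w. (norm (n' w))\<^sup>2) - expectation (\<lambda>w. \<delta> * (norm (y k w - xs))\<^sup>2 + 2 * \<sigma>2))"
    unfolding R_eq using int by (simp add: orth prob_space)
  also have "\<dots> \<le> (1 - \<omega> * \<mu> / 2) * R k + 12 * \<omega>\<^sup>2 * \<sigma>2"
    using mult_left_mono[OF n_le, of "2 * \<omega>\<^sup>2"] mult_left_mono[OF n'_le, of "4 * \<omega>\<^sup>2"]
    by (simp add: right_diff_distrib)
  finally show "R (Suc k) \<le> (1 - \<omega> * \<mu> / 2) * R k + 12 * \<omega>\<^sup>2 * \<sigma>2" .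
qed

lemma speg_square_integrable:
  assumes \<omega>: "0 < \<omega>" "\<omega> * L \<le> 1 / 4" "\<omega> * \<delta> \<le> \<mu> / 18"
  shows "square_integrable M (\<lambda>w. speg_iterate \<omega> k (\<lambda>j. v j w) - xs) \<and>
    square_integrable M (\<lambda>w. speg_iterate \<omega> k (\<lambda>j. v j w) - extrapolation \<omega> k (\<lambda>j. v j w))"
proof (induction k)
  case 0
  then show ?case
    by (simp add: initial_state square_integrable_const finite_measure_axioms)
next
  case (Suc k)
  then show ?case
    using speg_one_step(1,2)[OF \<omega>] by blast
qed

lemma step_size_bounds:
  assumes "0 < \<omega>" "\<omega> \<le> min (\<mu> / (18 * \<delta>)) (1 / (4 * L))"
  shows "\<omega> * L \<le> 1 / 4" "\<omega> * \<delta> \<le> \<mu> / 18" "\<omega> * \<mu> \<le> 1 / 4"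
proof -
  have L: "0 < L" using \<mu>_pos \<mu>_le_L by linarith
  show \<omega>L: "\<omega> * L \<le> 1 / 4" and "\<omega> * \<delta> \<le> \<mu> / 18"
    using assms L \<delta>_pos by (simp_all add: field_simps)
  show "\<omega> * \<mu> \<le> 1 / 4"
    using order_trans[OF mult_left_mono[OF \<mu>_le_L, of \<omega>] \<omega>L] assms by simp
qed

theorem speg_linear_convergence:
  assumes \<omega>: "0 < \<omega>" "\<omega> \<le> min (\<mu> / (18 * \<delta>)) (1 / (4 * L))"
  shows "integrable M (\<lambda>w. speg_sq_err (\<lambda>_. \<omega>) (\<lambda>_. \<omega>) Fs x0 (\<lambda>j. v j w) xs k)"
    and "speg_R2 M (\<lambda>_. \<omega>) (\<lambda>_. \<omega>) Fs x0 v xs k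
         \<le> (1 - \<omega> * \<mu> / 2) ^ k * speg_R2 M (\<lambda>_. \<omega>) (\<lambda>_. \<omega>) Fs x0 v xs 0 + 24 * \<omega> * \<sigma>2 / \<mu>"
proof -
  note b = step_size_bounds[OF \<omega>]
  note sq = speg_square_integrable[OF \<omega>(1) b(1,2)]
  show "integrable M (\<lambda>w. speg_sq_err (\<lambda>_. \<omega>) (\<lambda>_. \<omega>) Fs x0 (\<lambda>j. v j w) xs k)"
    using sq[of k] by (simp add: speg_sq_err_def square_integrable_def)
  show "speg_R2 M (\<lambda>_. \<omega>) (\<lambda>_. \<omega>) Fs x0 v xs k
      \<le> (1 - \<omega> * \<mu> / 2) ^ k * speg_R2 M (\<lambda>_. \<omega>) (\<lambda>_. \<omega>) Fs x0 v xs 0 + 24 * \<omega> * \<sigma>2 / \<mu>"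
  proof (rule le_geometric_plus_fixed_point)
    show "speg_R2 M (\<lambda>_. \<omega>) (\<lambda>_. \<omega>) Fs x0 v xs (Suc i)
        \<le> (1 - \<omega> * \<mu> / 2) * speg_R2 M (\<lambda>_. \<omega>) (\<lambda>_. \<omega>) Fs x0 v xs i + 12 * \<omega>\<^sup>2 * \<sigma>2" for i
      using speg_one_step(3)[OF \<omega>(1) b(1,2)] sq by blast
    show "0 \<le> 1 - \<omega> * \<mu> / 2" using b(3) by linarith
    show "0 \<le> 24 * \<omega> * \<sigma>2 / \<mu>" using \<omega>(1) \<sigma>2_nonneg \<mu>_pos by simp
    show "(1 - \<omega> * \<mu> / 2) * (24 * \<omega> * \<sigma>2 / \<mu>) + 12 * \<omega>\<^sup>2 * \<sigma>2 \<le> 24 * \<omega> * \<sigma>2 / \<mu>"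
      using \<mu>_pos by (simp add: field_simps power2_eq_square)
  qed
qed

theorem speg_complexity:
  assumes \<epsilon>: "0 < \<epsilon>"
    and \<omega>_def: "\<omega> = (if \<sigma>2 = 0 then min (\<mu> / (18 * \<delta>)) (1 / (4 * L))
                 else min (min (\<mu> / (18 * \<delta>)) (1 / (4 * L))) (\<epsilon> * \<mu> / (48 * \<sigma>2)))"
    and K: "real K \<ge> max (max (8 * L / \<mu>) (36 * \<delta> / \<mu>\<^sup>2)) (96 * \<sigma>2 / (\<epsilon> * \<mu>\<^sup>2))
                     * ln (2 * speg_R2 M (\<lambda>_. \<omega>) (\<lambda>_. \<omega>) Fs x0 v xs 0 / \<epsilon>)"
  shows "integrable M (\<lambda>w. (norm (speg_iterate \<omega> K (\<lambda>j. v j w) - xs))\<^sup>2)"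
    and "expectation (\<lambda>w. (norm (speg_iterate \<omega> K (\<lambda>j. v j w) - xs))\<^sup>2) \<le> \<epsilon>"
proof -
  let ?R = "\<lambda>k. speg_R2 M (\<lambda>_. \<omega>) (\<lambda>_. \<omega>) Fs x0 v xs k"
  have L: "0 < L" using \<mu>_pos \<mu>_le_L by linarith
  have a: "0 < \<mu> / (18 * \<delta>)" "0 < 1 / (4 * L)"
    using \<mu>_pos \<delta>_pos L by simp_all
  then have m: "0 < min (\<mu> / (18 * \<delta>)) (1 / (4 * L))" by simp
  have \<omega>_pos: "0 < \<omega>" and \<omega>_le: "\<omega> \<le> min (\<mu> / (18 * \<delta>)) (1 / (4 * L))"
    using m \<epsilon> \<mu>_pos \<sigma>2_nonneg by (auto simp: \<omega>_def)
  have two_over_m: "2 / (min (\<mu> / (18 * \<delta>)) (1 / (4 * L)) * \<mu>) = max (8 * L / \<mu>) (36 * \<delta> / \<mu>\<^sup>2)"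
    using two_over_min[OF a \<mu>_pos] \<mu>_pos \<delta>_pos L
    by (simp add: max.commute power2_eq_square)
  have rate: "2 / (\<omega> * \<mu>) = max (max (8 * L / \<mu>) (36 * \<delta> / \<mu>\<^sup>2)) (96 * \<sigma>2 / (\<epsilon> * \<mu>\<^sup>2))"
  proof (cases "\<sigma>2 = 0")
    case True
    have "0 \<le> max (8 * L / \<mu>) (36 * \<delta> / \<mu>\<^sup>2)"
      using L \<mu>_pos by (simp add: le_max_iff_disj)
    with True show ?thesis
      using two_over_m by (simp add: \<omega>_def)
  next
    case False
    then have s: "0 < \<epsilon> * \<mu> / (48 * \<sigma>2)"
      using \<epsilon> \<mu>_pos \<sigma>2_nonneg by simp
    show ?thesis
      using two_over_min[OF m s \<mu>_pos] False two_over_m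
      by (simp add: \<omega>_def power2_eq_square mult.assoc)
  qed
  have noise: "24 * \<omega> * \<sigma>2 / \<mu> \<le> \<epsilon> / 2"
  proof (cases "\<sigma>2 = 0")
    case False
    then have "\<omega> \<le> \<epsilon> * \<mu> / (48 * \<sigma>2)" "0 < \<sigma>2"
      using \<sigma>2_nonneg by (auto simp: \<omega>_def)
    then show ?thesis
      using \<mu>_pos by (simp add: field_simps)
  qed (use \<epsilon> in simp)

  note bounds = step_size_bounds[OF \<omega>_pos \<omega>_le]
  note sq = speg_square_integrable[OF \<omega>_pos bounds(1,2), of K]
  show int: "integrable M (\<lambda>w. (norm (speg_iterate \<omega> K (\<lambda>j. v j w) - xs))\<^sup>2)"
    using sq square_integrable_integrable by blast
  have "(1 - \<omega> * \<mu> / 2) ^ K * ?R 0 \<le> \<epsilon> / 2"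
  proof (rule geometric_le_after)
    show "0 \<le> ?R 0" by (simp add: speg_R2_def speg_sq_err_def)
    show "ln (?R 0 / (\<epsilon> / 2)) / (\<omega> * \<mu> / 2) \<le> real K"
      using K unfolding rate[symmetric] by (simp add: mult.commute)
  qed (use \<omega>_pos \<mu>_pos bounds(3) \<epsilon> in simp_all)
  then have "?R K \<le> \<epsilon>"
    using speg_linear_convergence(2)[OF \<omega>_pos \<omega>_le, of K] noise by linarith
  moreover have "expectation (\<lambda>w. (norm (speg_iterate \<omega> K (\<lambda>j. v j w) - xs))\<^sup>2) \<le> ?R K"
    unfolding speg_R2_def using speg_linear_convergence(1)[OF \<omega>_pos \<omega>_le, of K] int
    by (intro integral_mono) (simp_all add: speg_sq_err_def)
  ultimately show "expectation (\<lambda>w. (norm (speg_iterate \<omega> K (\<lambda>j. v j w) - xs))\<^sup>2) \<le> \<epsilon>"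
    by linarith
qed

end

theorem theorem2p1:
  fixes Fs :: "'n::finite \<Rightarrow> real^'d \<Rightarrow> real^'d"
    and D :: "(real^'n) measure"
    and M :: "'w measure"
    and v :: "int \<Rightarrow> 'w \<Rightarrow> real^'n"
    and x0 xs :: "real^'d"
    and L \<mu> \<delta> :: real
  assumes "\<And>i. Fs i \<in> borel_measurable borel"
    and "L-lipschitz_on UNIV (mean_op Fs)"
    and "quasi_strongly_monotone \<mu> (mean_op Fs) xs"
    and "sampling_distribution D"
    and "0 < \<delta>"
    and "expected_residual \<delta> D Fs xs"
    and "integrable D (\<lambda>u. (norm (stoch_op Fs u xs))\<^sup>2)"
    and "prob_space M"
    and "prob_space.indep_vars M (\<lambda>_. borel) v {-1..}"
    and "\<And>j. j \<ge> -1 \<Longrightarrow> distr M borel (v j) = D"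
  shows "(\<forall>\<omega> k. 0 < \<omega> \<and> \<omega> \<le> min (\<mu> / (18 * \<delta>)) (1 / (4 * L)) \<longrightarrow>
            integrable M (\<lambda>w. speg_sq_err (\<lambda>_. \<omega>) (\<lambda>_. \<omega>) Fs x0 (\<lambda>j. v j w) xs k) \<and>
            speg_R2 M (\<lambda>_. \<omega>) (\<lambda>_. \<omega>) Fs x0 v xs k
              \<le> (1 - \<omega> * \<mu> / 2) ^ k * speg_R2 M (\<lambda>_. \<omega>) (\<lambda>_. \<omega>) Fs x0 v xs 0
                + 24 * \<omega> * noise_at_solution D Fs xs / \<mu>)
       \<and> (\<forall>\<epsilon> \<omega> K. 0 < \<epsilon> \<and>
            \<omega> = (if noise_at_solution D Fs xs = 0
                 then min (\<mu> / (18 * \<delta>)) (1 / (4 * L))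
                 else min (min (\<mu> / (18 * \<delta>)) (1 / (4 * L)))
                          (\<epsilon> * \<mu> / (48 * noise_at_solution D Fs xs))) \<and>
            real K \<ge> max (max (8 * L / \<mu>) (36 * \<delta> / \<mu>\<^sup>2))
                         (96 * noise_at_solution D Fs xs / (\<epsilon> * \<mu>\<^sup>2))
                     * ln (2 * speg_R2 M (\<lambda>_. \<omega>) (\<lambda>_. \<omega>) Fs x0 v xs 0 / \<epsilon>) \<longrightarrow>
            integrable M (\<lambda>w. (norm (speg_x (\<lambda>_. \<omega>) (\<lambda>_. \<omega>) Fs x0 (\<lambda>j. v j w) K - xs))\<^sup>2) \<and>
            (\<integral>w. (norm (speg_x (\<lambda>_. \<omega>) (\<lambda>_. \<omega>) Fs x0 (\<lambda>j. v j w) K - xs))\<^sup>2 \<partial>M) \<le> \<epsilon>)"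
proof -
  interpret speg M Fs D v x0 xs L \<mu> \<delta>
    using assms unfolding speg_def speg_axioms_def by blast
  show ?thesis
    using speg_linear_convergence speg_complexity by blast
qed

end
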